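(* Let $G$ be a simple graph with $m$ edges. Then $$DSO(G) \leq \frac{\sqrt{2}}{2}\big(Alb(G)+m\big).$$ Equality holds if and only if $G$ consists of components each of which is a regular graph (not necessarily of equal degree).
   Context: For a simple graph $G=(V,E)$, $d_u$ denotes the degree of vertex $u$. The Diminished Sombor index is $DSO(G)=\sum_{uv\in E}\frac{\sqrt{d_u^2+d_v^2}}{d_u+d_v}$, and the Albertson index is $Alb(G)=\sum_{uv\in E}|d_u-d_v|$. *)

theory Defs
  imports Complex_Main "Graph_Theory.Digraph_Component"
begin

text \<open>
  A simple graph is an instance of the locale \<^locale>\<open>graph\<close>: a finite symmetric digraph
  without loops and parallel arcs. An undirected edge is thus a pair of opposite arcs; it is
  represented here by the two-element set of its ends, so that it is counted once.
\<close>

definition edges :: "('a, 'b) pre_digraph \<Rightarrow> 'a set set" where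
  "edges G = {{u, v} | u v. u \<rightarrow>\<^bsub>G\<^esub> v}"

text \<open>
  By symmetry, in-degree and out-degree coincide, and both are the number of neighbours
  (see \<open>degree_eq_card_neighbours\<close> below).
\<close>

definition degree :: "('a, 'b) pre_digraph \<Rightarrow> 'a \<Rightarrow> nat" where
  "degree G u = out_degree G u"

text \<open>
  The value of \<open>f u v\<close> at an edge \<open>e = {u, v}\<close>. It is only used for symmetric \<open>f\<close>,
  where the choice of orientation is irrelevant (see \<open>on_edge_doubleton\<close> below).
\<close>

definition on_edge :: "('a \<Rightarrow> 'a \<Rightarrow> 'c) \<Rightarrow> 'a set \<Rightarrow> 'c" where
  "on_edge f e = (case (SOME (u, v). e = {u, v}) of (u, v) \<Rightarrow> f u v)"

definition DSO :: "('a, 'b) pre_digraph \<Rightarrow> real" where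
  "DSO G = (\<Sum>e\<in>edges G. on_edge (\<lambda>u v.
     sqrt ((real (degree G u))\<^sup>2 + (real (degree G v))\<^sup>2)
       / (real (degree G u) + real (degree G v))) e)"

definition Alb :: "('a, 'b) pre_digraph \<Rightarrow> real" where
  "Alb G = (\<Sum>e\<in>edges G. on_edge (\<lambda>u v. \<bar>real (degree G u) - real (degree G v)\<bar>) e)"

text \<open>
  The constant \<open>connected\<close> must be qualified, as \<^theory>\<open>Complex_Main\<close> also
  provides topological connectedness.
\<close>

definition components :: "('a, 'b) pre_digraph \<Rightarrow> ('a, 'b) pre_digraph set" where
  "components G = {H. pre_digraph.max_subgraph G Digraph_Component.connected H}"

definition regular :: "('a, 'b) pre_digraph \<Rightarrow> bool" where
  "regular G \<longleftrightarrow> (\<exists>k. \<forall>v\<in>verts G. degree G v = k)"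

lemma on_edge_doubleton:
  assumes "\<And>x y. f x y = f y x"
  shows "on_edge f {u, v} = f u v"
proof -
  obtain x y where xy: "(SOME (x, y). {u, v} = {x, y}) = (x, y)"
    by (cases "SOME (x, y). {u, v} = {x, y}") auto
  have "case (SOME (x, y). {u, v} = {x, y}) of (x, y) \<Rightarrow> {u, v} = {x, y}"
    by (rule someI[of "\<lambda>(x, y). {u, v} = {x, y}" "(u, v)"]) simp
  then have "{u, v} = {x, y}" by (simp add: xy)
  then have "f x y = f u v" using assms by (auto simp: doubleton_eq_iff)
  then show ?thesis by (simp add: on_edge_def xy)
qed

lemma degree_eq_card_neighbours:
  assumes "graph G"
  shows "degree G u = card {v. {u, v} \<in> edges G}"
proof -
  interpret graph G by fact
  have "{v. {u, v} \<in> edges G} = {v. u \<rightarrow>\<^bsub>G\<^esub> v}"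
    using graph_symmetric by (auto simp: edges_def doubleton_eq_iff)
  also have "\<dots> = head G ` out_arcs G u"
    by (auto simp: arcs_ends_conv out_arcs_def)
  finally have eq: "{v. {u, v} \<in> edges G} = head G ` out_arcs G u" .
  have "inj_on (head G) (out_arcs G u)"
    using no_multi_arcs by (auto simp: inj_on_def out_arcs_def arc_to_ends_def)
  then show ?thesis
    by (simp add: eq card_image degree_def out_degree_def)
qed

end

theory Submission
  imports Defs
begin

text \<open>
  The bound holds edge by edge: \<open>2 (a\<^sup>2 + b\<^sup>2) = (a - b)\<^sup>2 + (a + b)\<^sup>2 \<le> (\<bar>a - b\<bar> + (a + b))\<^sup>2\<close>,
  and dividing by \<open>a + b \<ge> 1\<close> only decreases \<open>\<bar>a - b\<bar>\<close>. Both steps are equalities for \<open>a = b\<close>,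
  and the first one is strict otherwise. So equality means that adjacent vertices have equal
  degrees, which is to say that the degree is constant on every component.
\<close>

lemma sqrt_sum_squares_quotient_less:
  fixes a b :: real
  assumes "a \<ge> 1" "b \<ge> 1" "a \<noteq> b"
  shows "sqrt (a\<^sup>2 + b\<^sup>2) / (a + b) < sqrt 2 / 2 * (\<bar>a - b\<bar> + 1)"
proof -
  \<comment> \<open>Twice this product is the cross term by which
    \<open>(\<bar>a - b\<bar> + (a + b))\<^sup>2\<close> exceeds
    \<open>2 * (a\<^sup>2 + b\<^sup>2)\<close>; its positivity is the source of strictness.\<close>
  have "0 < \<bar>a - b\<bar> * (a + b)" using assms by simp
  then have "2 * (a\<^sup>2 + b\<^sup>2) < (\<bar>a - b\<bar> + (a + b))\<^sup>2"
    using power2_abs[of "a - b"] by (simp add: power2_sum power2_diff mult.commute)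
  then have "sqrt (2 * (a\<^sup>2 + b\<^sup>2)) < \<bar>a - b\<bar> + (a + b)"
    using assms by (intro real_less_lsqrt) auto
  also have "\<dots> \<le> (\<bar>a - b\<bar> + 1) * (a + b)"
    using assms mult_left_mono[of 1 "a + b" "\<bar>a - b\<bar>"] by (simp add: algebra_simps)
  \<comment> \<open>The extra factor \<open>sqrt 2\<close> turns the left side into
    \<open>2 * sqrt (a\<^sup>2 + b\<^sup>2)\<close>, so that division by \<open>2 * (a + b)\<close>
    yields the claim.\<close>
  finally have "sqrt 2 * (sqrt 2 * sqrt (a\<^sup>2 + b\<^sup>2)) < sqrt 2 * ((\<bar>a - b\<bar> + 1) * (a + b))"
    by (simp only: real_sqrt_mult mult_less_cancel_left_pos real_sqrt_gt_0_iff zero_less_numeral)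
  then have "2 * sqrt (a\<^sup>2 + b\<^sup>2) < sqrt 2 * ((\<bar>a - b\<bar> + 1) * (a + b))"
    by (simp only: mult.assoc[symmetric] real_sqrt_mult_self abs_numeral)
  then show ?thesis
    using assms by (simp add: field_simps)
qed

lemma sqrt_sum_squares_quotient_same:
  fixes a :: real
  assumes "a > 0"
  shows "sqrt (a\<^sup>2 + a\<^sup>2) / (a + a) = sqrt 2 / 2"
  using assms by (simp add: real_sqrt_mult flip: mult_2)

lemma strongly_connected_imp_connected:
  assumes "wf_digraph G" "strongly_connected G"
  shows "Digraph_Component.connected G"
  using assms wf_digraph.reachable_mk_symmetricI[of G]
  by (auto simp: strongly_connected_def intro!: wf_digraph.connectedI)

text \<open>Extra arcs on the same vertices cannot destroy connectedness. Hence a maximal connected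
  subgraph is induced, which makes it symmetric when \<open>G\<close> is.\<close>

lemma arc_mono_connected: "arc_mono Digraph_Component.connected"
  unfolding arc_mono_def
  by (metis spanning_def subgraphE wf_digraph.connected_spanning_imp_connected)

text \<open>For induced subgraphs of a symmetric digraph, connected and strongly connected mean the
  same. The identification makes the reachability description of \<open>sccs_verts\<close> available
  for components.\<close>

lemma (in sym_digraph) components_eq_sccs: "components G = sccs"
proof (intro equalityI subsetI)
  fix H assume "H \<in> components G"
  then have H: "max_subgraph Digraph_Component.connected H" by (simp add: components_def)
  then have "induced_subgraph H G" by (rule induced_subgraphI_arc_mono[OF _ arc_mono_connected])
  then have "strongly_connected H"
    using max_subgraph_prop[OF H] induced_graph_imp_symmetric[OF sym_arcs]
    by (blast intro: wf_digraph.symmetric_connected_imp_strongly_connected wf_digraphI_induced)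
  moreover have "H' = H" if "strongly_connected H'" "subgraph H H'" "subgraph H' G" for H'
    using H that strongly_connected_imp_connected[of H'] by (auto simp: max_subgraph_def)
  ultimately show "H \<in> sccs"
    using subgraphI_max_subgraph[OF H] by (auto simp: sccs_altdef2 intro!: max_subgraphI)
next
  fix H assume H: "H \<in> sccs"
  then have sub: "subgraph H G" and ind: "induced_subgraph H G" and sc: "strongly_connected H"
    by (auto simp: sccs_def induced_imp_subgraph)
  have "H' = H" if H': "subgraph H H'" "subgraph H' G" "Digraph_Component.connected H'" for H'
  proof -
    \<comment> \<open>\<open>H'\<close> may contain an arc without its opposite, so it need not be
      strongly connected. The induced subgraph on its vertices is symmetric and still
      connected.\<close>
    let ?K = "G \<restriction> verts H'"
    have K: "induced_subgraph ?K G"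
      using H'(2) by (intro induced_induce) (rule subgraph_imp_subverts)
    have "Digraph_Component.connected ?K"
      using H' arc_mono_connected[unfolded arc_mono_def, rule_format, of H' ?K]
      by (simp add: subgraph_induce_subgraphI2)
    then have "strongly_connected ?K"
      using induced_graph_imp_symmetric[OF sym_arcs K]
      by (intro wf_digraph.symmetric_connected_imp_strongly_connected) auto
    \<comment> \<open>Maximality in \<open>sccs_def\<close> compares only vertex sets of induced
      subgraphs. That \<open>H'\<close> has no further arcs follows afterwards, because
      \<open>H\<close> is induced.\<close>
    then have "\<not> verts H \<subset> verts ?K"
      using H K unfolding sccs_def by blast
    then have "verts H' = verts H"
      using subgraph_imp_subverts[OF H'(1)] by auto
    then show "H' = H"
      using ind H' by (auto simp: induced_subgraph_altdef2 max_subgraph_def)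
  qed
  moreover have "Digraph_Component.connected H"
    using sc sub by (intro strongly_connected_imp_connected) auto
  ultimately show "H \<in> components G"
    unfolding components_def using sub by (auto intro!: max_subgraphI)
qed

lemma (in sym_digraph) component_adj_closed:
  assumes "H \<in> components G" "u \<in> verts H" "u \<rightarrow>\<^bsub>G\<^esub> v"
  shows "v \<in> verts H"
proof -
  have "verts H \<in> sccs_verts" using assms(1) by (simp add: components_eq_sccs sccs_verts_conv)
  then show ?thesis
    using assms(2,3) symmetric_reachable'[of u v] by (auto simp: in_sccs_verts_conv_reachable)
qed

text \<open>A component is induced and closed under adjacency, so it keeps every arc of
  \<open>G\<close> that starts at one of its vertices.\<close>

lemma (in sym_digraph) degree_component:
  assumes "H \<in> components G" "u \<in> verts H"
  shows "degree H u = degree G u"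
proof -
  have ind: "induced_subgraph H G" using assms(1) by (simp add: components_eq_sccs sccs_def)
  then have "compatible G H" by (auto simp: induced_subgraph_def)
  then have tail: "tail H = tail G" by (simp add: compatible_tail)
  have "head G e \<in> verts H" if "e \<in> arcs G" "tail G e = u" for e
    using component_adj_closed[OF assms] that in_arcs_imp_in_arcs_ends[of e] by auto
  then have "out_arcs H u = out_arcs G u"
    using ind assms(2) by (auto simp: induced_subgraph_def out_arcs_def tail)
  then show ?thesis by (simp add: degree_def out_degree_def)
qed

text \<open>Adjacent vertices share a component; conversely, equality of degrees propagates along
  walks, and these join any two vertices of a component.\<close>

lemma (in sym_digraph) all_components_regular_iff:
  "(\<forall>H\<in>components G. regular H) \<longleftrightarrow> (\<forall>u v. u \<rightarrow>\<^bsub>G\<^esub> v \<longrightarrow> degree G u = degree G v)"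
proof (intro iffI allI impI ballI)
  fix u v assume reg: "\<forall>H\<in>components G. regular H" and uv: "u \<rightarrow>\<^bsub>G\<^esub> v"
  \<comment> \<open>By symmetry, the vertices reachable from \<open>u\<close> induce the component
    of \<open>u\<close>.\<close>
  let ?H = "G \<restriction> {w. u \<rightarrow>\<^sup>*\<^bsub>G\<^esub> w}"
  have H: "?H \<in> components G"
    using uv by (simp add: components_eq_sccs induce_reachable_is_in_sccs adj_in_verts)
  have "u \<in> verts ?H" "v \<in> verts ?H" using uv by (auto simp: adj_in_verts)
  then show "degree G u = degree G v"
    using reg H degree_component[OF H] unfolding regular_def by metis
next
  fix H assume adj: "\<forall>u v. u \<rightarrow>\<^bsub>G\<^esub> v \<longrightarrow> degree G u = degree G v" and H: "H \<in> components G"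
  have reach: "degree G u = degree G v" if "u \<rightarrow>\<^sup>*\<^bsub>G\<^esub> v" for u v
    using that adj by induct auto
  have "verts H \<in> sccs_verts" using H by (simp add: components_eq_sccs sccs_verts_conv)
  then have "degree H u = degree H v" if "u \<in> verts H" "v \<in> verts H" for u v
    using that reach by (auto simp: degree_component[OF H] in_sccs_verts_conv_reachable)
  then show "regular H" unfolding regular_def by metis
qed

lemma (in graph) degree_pos:
  assumes "u \<rightarrow>\<^bsub>G\<^esub> v"
  shows "degree G u \<ge> 1" "degree G v \<ge> 1"
proof -
  have "degree G x \<ge> 1" if "x \<rightarrow>\<^bsub>G\<^esub> y" for x y
  proof -
    have "out_arcs G x \<noteq> {}" using that by (auto simp: out_arcs_def)
    then show ?thesis
      by (simp add: degree_def out_degree_def Suc_le_eq card_gt_0_iff finite_out_arcs)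
  qed
  then show "degree G u \<ge> 1" "degree G v \<ge> 1" using assms graph_symmetric by blast+
qed

theorem theorem3p2:
  fixes G :: "('a, 'b) pre_digraph" and m :: nat
  assumes "graph G" and "card (edges G) = m"
  shows "DSO G \<le> sqrt 2 / 2 * (Alb G + real m) \<and>
    (DSO G = sqrt 2 / 2 * (Alb G + real m) \<longleftrightarrow> (\<forall>H\<in>components G. regular H))"
proof -
  interpret graph G by fact
  let ?d = "\<lambda>u. real (degree G u)"
  define f where "f u v = sqrt ((?d u)\<^sup>2 + (?d v)\<^sup>2) / (?d u + ?d v)" for u v
  define g where "g u v = \<bar>?d u - ?d v\<bar>" for u v
  \<comment> \<open>The summand 1 distributes \<open>m\<close>, the number of edges, over the edges,
    so that both sides can be compared term by term.\<close>
  define R where "R e = sqrt 2 / 2 * (on_edge g e + 1)" for e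
  have f_edge: "on_edge f {u, v} = f u v" for u v
    by (rule on_edge_doubleton) (simp add: f_def add.commute)
  have g_edge: "on_edge g {u, v} = g u v" for u v
    by (rule on_edge_doubleton) (simp add: g_def abs_minus_commute)
  have "edges G = (\<lambda>(u, v). {u, v}) ` arcs_ends G"
    by (auto simp: edges_def)
  then have fin: "finite (edges G)" by (simp add: arcs_ends_def)
  have DSO: "DSO G = (\<Sum>e\<in>edges G. on_edge f e)"
    by (simp add: DSO_def f_def[abs_def])
  have RHS: "sqrt 2 / 2 * (Alb G + real m) = (\<Sum>e\<in>edges G. R e)"
    using assms(2)
    by (simp add: Alb_def g_def[abs_def] R_def sum.distrib sum_distrib_left distrib_left)
  have eq: "on_edge f {u, v} = R {u, v}" if "u \<rightarrow>\<^bsub>G\<^esub> v" "degree G u = degree G v" for u v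
    using degree_pos[OF that(1)] that(2) sqrt_sum_squares_quotient_same[of "?d u"]
    by (simp add: f_edge g_edge R_def f_def g_def)
  have less: "on_edge f {u, v} < R {u, v}" if "u \<rightarrow>\<^bsub>G\<^esub> v" "degree G u \<noteq> degree G v" for u v
    using degree_pos[OF that(1)] that(2) sqrt_sum_squares_quotient_less[of "?d u" "?d v"]
    by (simp add: f_edge g_edge R_def f_def g_def)
  have le: "on_edge f e \<le> R e" if "e \<in> edges G" for e
  proof -
    obtain u v where "e = {u, v}" "u \<rightarrow>\<^bsub>G\<^esub> v" using \<open>e \<in> edges G\<close> unfolding edges_def by blast
    then show ?thesis using eq[of u v] less[of u v] by (cases "degree G u = degree G v") auto
  qed
  \<comment> \<open>Given \<open>le\<close> on a finite set of edges, the two sums agree only if all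
    their terms do.\<close>
  have "DSO G = sqrt 2 / 2 * (Alb G + real m) \<longleftrightarrow> (\<forall>e\<in>edges G. on_edge f e = R e)"
    unfolding DSO RHS
    using sum_mono_inv[where f = "on_edge f" and g = R, OF _ le _ fin]
      sum.cong[of "edges G" "edges G" "on_edge f" R] by blast
  also have "\<dots> \<longleftrightarrow> (\<forall>u v. u \<rightarrow>\<^bsub>G\<^esub> v \<longrightarrow> on_edge f {u, v} = R {u, v})"
    unfolding edges_def by blast
  also have "\<dots> \<longleftrightarrow> (\<forall>u v. u \<rightarrow>\<^bsub>G\<^esub> v \<longrightarrow> degree G u = degree G v)"
    using eq less by (metis less_irrefl)
  also have "\<dots> \<longleftrightarrow> (\<forall>H\<in>components G. regular H)"
    by (rule all_components_regular_iff[symmetric])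
  finally have "DSO G = sqrt 2 / 2 * (Alb G + real m) \<longleftrightarrow> (\<forall>H\<in>components G. regular H)" .
  moreover have "DSO G \<le> sqrt 2 / 2 * (Alb G + real m)"
    unfolding DSO RHS by (intro sum_mono le)
  ultimately show ?thesis by blast
qed

end
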